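(* Let $(\mathcal{A},\cdot)$ be a symmetric Zinbiel superalgebra over $\mathbb{C}$ with nonzero multiplication which is not $2$-step nilpotent. Then: (1) $(\mathcal{A},\cdot)$ is a $3$-step nilpotent superalgebra, i.e. it is a central extension of a $2$-step nilpotent superalgebra; (2) $x^3=0$, that is $(xx)x=x(xx)=0$, for each homogeneous element $x\in\mathcal{A}$.
   Context: A superalgebra is a finite-dimensional $\mathbb{Z}_2$-graded vector space $\mathcal{A}=\mathcal{A}_{\bar 0}\oplus\mathcal{A}_{\bar 1}$ with a bilinear product satisfying $\mathcal{A}_i\mathcal{A}_j\subset\mathcal{A}_{i+j}$; $|x|$ denotes the degree of a homogeneous element $x$. $\mathcal{A}$ is a left Zinbiel superalgebra if $(xy)z=x(yz)+(-1)^{|y||z|}x(zy)$ for all homogeneous $x,y,z$; it is a right Zinbiel superalgebra if $x(yz)=(xy)z+(-1)^{|x||y|}(yx)z$ for all homogeneous $x,y,z$; it is symmetric Zinbiel if it is both left and right Zinbiel. A superalgebra is $2$-step nilpotent if $(xy)z=x(yz)=0$ for all $x,y,z$ but the product is nonzero. It is $3$-step nilpotent if $(xy)(zt)=x((yz)t)=x(y(zt))=((xy)z)t=(x(yz))t=0$ for all $x,y,z,t$ but it is not $2$-step nilpotent. The annihilator of $\mathcal{A}$ is $\{a\in\mathcal{A}: a\mathcal{A}=\mathcal{A}a=0\}$; $\mathcal{A}$ is a central extension of a superalgebra $\mathcal{B}$ if $\mathcal{B}\cong\mathcal{A}/\mathcal{I}$ for some graded ideal $\mathcal{I}$ contained in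 the annihilator of $\mathcal{A}$. *)

theory Defs
  imports
    "HOL-Algebra.Algebra"
    "HOL-Algebra.Algebraic_Closure_Type"
    "HOL-Library.Z2"
    Complex_Main
begin

abbreviation complex_ring :: "complex ring"
  where "complex_ring \<equiv> ring_of_type_algebra"

text \<open>
  The record of a module over the complex numbers already carries a multiplication, which the
  locale \<^locale>\<open>module\<close> leaves unconstrained; here it is the (nonassociative) product of the
  superalgebra.  The inherited field \<^const>\<open>one\<close> has no meaning and is ignored throughout.
  Degrees are elements of the two-element field \<^typ>\<open>bit\<close>.
\<close>

record 'a superalgebra = "(complex, 'a) module" +
  homog :: "bit \<Rightarrow> 'a set"

locale superalgebra = module complex_ring A for A :: "'a superalgebra" (structure) +
  assumes finite_dimensional:
      "\<exists>S. finite S \<and> S \<subseteq> carrier A \<and>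
           (\<forall>x \<in> carrier A. \<exists>c :: 'a \<Rightarrow> complex. x = (\<Oplus>\<^bsub>A\<^esub>s\<in>S. c s \<odot>\<^bsub>A\<^esub> s))"
    and homog_submodule: "submodule (homog A i) complex_ring A"
    and homog_sum: "homog A 0 <+>\<^bsub>A\<^esub> homog A 1 = carrier A"
    and homog_Int: "homog A 0 \<inter> homog A 1 = {\<zero>\<^bsub>A\<^esub>}"
    and mult_closed: "\<lbrakk>x \<in> carrier A; y \<in> carrier A\<rbrakk> \<Longrightarrow> x \<otimes>\<^bsub>A\<^esub> y \<in> carrier A"
    and mult_add_left: "\<lbrakk>x \<in> carrier A; y \<in> carrier A; z \<in> carrier A\<rbrakk> \<Longrightarrow>
      (x \<oplus>\<^bsub>A\<^esub> y) \<otimes>\<^bsub>A\<^esub> z = x \<otimes>\<^bsub>A\<^esub> z \<oplus>\<^bsub>A\<^esub> y \<otimes>\<^bsub>A\<^esub> z"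
    and mult_add_right: "\<lbrakk>x \<in> carrier A; y \<in> carrier A; z \<in> carrier A\<rbrakk> \<Longrightarrow>
      x \<otimes>\<^bsub>A\<^esub> (y \<oplus>\<^bsub>A\<^esub> z) = x \<otimes>\<^bsub>A\<^esub> y \<oplus>\<^bsub>A\<^esub> x \<otimes>\<^bsub>A\<^esub> z"
    and mult_smult_left: "\<lbrakk>x \<in> carrier A; y \<in> carrier A\<rbrakk> \<Longrightarrow>
      (c \<odot>\<^bsub>A\<^esub> x) \<otimes>\<^bsub>A\<^esub> y = c \<odot>\<^bsub>A\<^esub> (x \<otimes>\<^bsub>A\<^esub> y)"
    and mult_smult_right: "\<lbrakk>x \<in> carrier A; y \<in> carrier A\<rbrakk> \<Longrightarrow>
      x \<otimes>\<^bsub>A\<^esub> (c \<odot>\<^bsub>A\<^esub> y) = c \<odot>\<^bsub>A\<^esub> (x \<otimes>\<^bsub>A\<^esub> y)"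
    and mult_homog: "\<lbrakk>x \<in> homog A i; y \<in> homog A j\<rbrakk> \<Longrightarrow> x \<otimes>\<^bsub>A\<^esub> y \<in> homog A (i + j)"

text \<open>The sign \<open>(-1)\<close> to the power \<open>i j\<close>.\<close>

definition super_sign :: "bit \<Rightarrow> bit \<Rightarrow> complex"
  where "super_sign i j = (if i = 1 \<and> j = 1 then - 1 else 1)"

locale left_zinbiel_superalgebra = superalgebra +
  assumes left_zinbiel: "\<lbrakk>x \<in> homog A i; y \<in> homog A j; z \<in> homog A k\<rbrakk> \<Longrightarrow>
    (x \<otimes>\<^bsub>A\<^esub> y) \<otimes>\<^bsub>A\<^esub> z =
      x \<otimes>\<^bsub>A\<^esub> (y \<otimes>\<^bsub>A\<^esub> z) \<oplus>\<^bsub>A\<^esub> super_sign j k \<odot>\<^bsub>A\<^esub> (x \<otimes>\<^bsub>A\<^esub> (z \<otimes>\<^bsub>A\<^esub> y))"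

locale right_zinbiel_superalgebra = superalgebra +
  assumes right_zinbiel: "\<lbrakk>x \<in> homog A i; y \<in> homog A j; z \<in> homog A k\<rbrakk> \<Longrightarrow>
    x \<otimes>\<^bsub>A\<^esub> (y \<otimes>\<^bsub>A\<^esub> z) =
      (x \<otimes>\<^bsub>A\<^esub> y) \<otimes>\<^bsub>A\<^esub> z \<oplus>\<^bsub>A\<^esub> super_sign i j \<odot>\<^bsub>A\<^esub> ((y \<otimes>\<^bsub>A\<^esub> x) \<otimes>\<^bsub>A\<^esub> z)"

locale symmetric_zinbiel_superalgebra =
  left_zinbiel_superalgebra + right_zinbiel_superalgebra

definition nonzero_mult :: "'a superalgebra \<Rightarrow> bool"
  where "nonzero_mult A \<longleftrightarrow> (\<exists>x \<in> carrier A. \<exists>y \<in> carrier A. x \<otimes>\<^bsub>A\<^esub> y \<noteq> \<zero>\<^bsub>A\<^esub>)"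

definition two_step_nilpotent :: "'a superalgebra \<Rightarrow> bool"
  where "two_step_nilpotent A \<longleftrightarrow>
    (\<forall>x \<in> carrier A. \<forall>y \<in> carrier A. \<forall>z \<in> carrier A.
       (x \<otimes>\<^bsub>A\<^esub> y) \<otimes>\<^bsub>A\<^esub> z = \<zero>\<^bsub>A\<^esub> \<and> x \<otimes>\<^bsub>A\<^esub> (y \<otimes>\<^bsub>A\<^esub> z) = \<zero>\<^bsub>A\<^esub>) \<and>
    nonzero_mult A"

definition three_step_nilpotent :: "'a superalgebra \<Rightarrow> bool"
  where "three_step_nilpotent A \<longleftrightarrow>
    (\<forall>x \<in> carrier A. \<forall>y \<in> carrier A. \<forall>z \<in> carrier A. \<forall>t \<in> carrier A.
       (x \<otimes>\<^bsub>A\<^esub> y) \<otimes>\<^bsub>A\<^esub> (z \<otimes>\<^bsub>A\<^esub> t) = \<zero>\<^bsub>A\<^esub> \<and>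
       x \<otimes>\<^bsub>A\<^esub> ((y \<otimes>\<^bsub>A\<^esub> z) \<otimes>\<^bsub>A\<^esub> t) = \<zero>\<^bsub>A\<^esub> \<and>
       x \<otimes>\<^bsub>A\<^esub> (y \<otimes>\<^bsub>A\<^esub> (z \<otimes>\<^bsub>A\<^esub> t)) = \<zero>\<^bsub>A\<^esub> \<and>
       ((x \<otimes>\<^bsub>A\<^esub> y) \<otimes>\<^bsub>A\<^esub> z) \<otimes>\<^bsub>A\<^esub> t = \<zero>\<^bsub>A\<^esub> \<and>
       (x \<otimes>\<^bsub>A\<^esub> (y \<otimes>\<^bsub>A\<^esub> z)) \<otimes>\<^bsub>A\<^esub> t = \<zero>\<^bsub>A\<^esub>) \<and>
    \<not> two_step_nilpotent A"

definition annihilator :: "'a superalgebra \<Rightarrow> 'a set"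
  where "annihilator A =
    {a \<in> carrier A. \<forall>x \<in> carrier A. a \<otimes>\<^bsub>A\<^esub> x = \<zero>\<^bsub>A\<^esub> \<and> x \<otimes>\<^bsub>A\<^esub> a = \<zero>\<^bsub>A\<^esub>}"

definition graded_ideal :: "'a set \<Rightarrow> 'a superalgebra \<Rightarrow> bool"
  where "graded_ideal I A \<longleftrightarrow>
    submodule I complex_ring A \<and>
    (\<forall>a \<in> I. \<forall>x \<in> carrier A. a \<otimes>\<^bsub>A\<^esub> x \<in> I \<and> x \<otimes>\<^bsub>A\<^esub> a \<in> I) \<and>
    I = (I \<inter> homog A 0) <+>\<^bsub>A\<^esub> (I \<inter> homog A 1)"

text \<open>
  The ring part is that of \<^const>\<open>FactRing\<close>.  Scaling takes a union of cosets instead of the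
  elementwise image, since the latter would send every coset to the zero singleton for scalar 0.
\<close>

definition quotient_superalgebra :: "'a superalgebra \<Rightarrow> 'a set \<Rightarrow> 'a set superalgebra"
  where "quotient_superalgebra A I =
    \<lparr>carrier = a_rcosets\<^bsub>A\<^esub> I, monoid.mult = rcoset_mult A I, one = I +>\<^bsub>A\<^esub> \<one>\<^bsub>A\<^esub>,
     ring.zero = I, add = set_add A,
     module.smult = (\<lambda>c U. \<Union>x\<in>U. I +>\<^bsub>A\<^esub> (c \<odot>\<^bsub>A\<^esub> x)),
     homog = (\<lambda>i. (\<lambda>x. I +>\<^bsub>A\<^esub> x) ` homog A i)\<rparr>"

definition superalgebra_iso :: "'a superalgebra \<Rightarrow> 'b superalgebra \<Rightarrow> ('a \<Rightarrow> 'b) set"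
  where "superalgebra_iso A B =
    {h. bij_betw h (carrier A) (carrier B) \<and>
        h \<in> hom (add_monoid A) (add_monoid B) \<and>
        h \<in> hom A B \<and>
        (\<forall>c. \<forall>x \<in> carrier A. h (c \<odot>\<^bsub>A\<^esub> x) = c \<odot>\<^bsub>B\<^esub> h x) \<and>
        (\<forall>i. h ` homog A i = homog B i)}"

definition central_extension :: "'a superalgebra \<Rightarrow> 'b superalgebra \<Rightarrow> bool"
  where "central_extension A B \<longleftrightarrow>
    (\<exists>I. graded_ideal I A \<and> I \<subseteq> annihilator A \<and>
         superalgebra_iso B (quotient_superalgebra A I) \<noteq> {})"

end

theory Submission
  imports Defs
begin

text \<open>
  Signs aside, subtracting the two Zinbiel identities gives \<open>(x y) z = - y (z x)\<close>, so every product
  of four elements reduces to the right-nested form \<open>x (y (z t))\<close>.  The left identity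
  then shows that \<open>x (y z)\<close> is symmetric in \<open>x\<close> and \<open>y\<close> and that its cyclic sum vanishes.  Hence
  \<open>x (y (z t))\<close> is symmetric in all four arguments, since comparing \<open>x\<close> times the cyclic identity
  for \<open>y, z, t\<close> with \<open>y\<close> times the one for \<open>x, z, t\<close> allows the last argument to be exchanged too;
  the cyclic identity becomes \<open>3 x (y (z t)) = 0\<close>.  Dividing by the annihilator, which is a graded
  ideal containing all triple products, yields the two-step nilpotent quotient.
\<close>

section \<open>Signs and the arithmetic of complex scalars\<close>

lemma super_sign_commute: "super_sign i j = super_sign j i"
  by (simp add: super_sign_def)

text \<open>A sign is its own inverse: multiplying an equation by the same sign again is how signs
  are cleared below.\<close>

lemma super_sign_square [simp]: "super_sign i j * super_sign i j = 1"
  by (simp add: super_sign_def)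

text \<open>The module laws are restated with the ordinary operations on complex numbers, so that
  \<open>simp\<close> can compute with signs. The record scheme is left open; the instances are a
  superalgebra and its quotients.\<close>

locale complex_module = module complex_ring M for M :: "(complex, 'a, 'm) module_scheme" (structure)
begin

lemma scalar_smult_closed [simp, intro]: "x \<in> carrier M \<Longrightarrow> c \<odot> x \<in> carrier M"
  using smult_closed[of c x] by (simp add: ring_of_type_algebra_def)

lemma scalar_smult_assoc: "x \<in> carrier M \<Longrightarrow> a \<odot> (b \<odot> x) = (a * b) \<odot> x"
  using smult_assoc1[of a b x] by (simp add: ring_of_type_algebra_def)

lemma scalar_smult_add_left: "x \<in> carrier M \<Longrightarrow> (a + b) \<odot> x = a \<odot> x \<oplus> b \<odot> x"
  using smult_l_distr[of a b x] by (simp add: ring_of_type_algebra_def)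

lemma scalar_smult_add_right:
  "\<lbrakk>x \<in> carrier M; y \<in> carrier M\<rbrakk> \<Longrightarrow> c \<odot> (x \<oplus> y) = c \<odot> x \<oplus> c \<odot> y"
  using smult_r_distr[of c x y] by (simp add: ring_of_type_algebra_def)

lemma scalar_smult_one [simp]: "x \<in> carrier M \<Longrightarrow> 1 \<odot> x = x"
  using smult_one[of x] by (simp add: ring_of_type_algebra_def)

lemma scalar_smult_zero_left [simp]: "x \<in> carrier M \<Longrightarrow> 0 \<odot> x = \<zero>"
  using smult_l_null[of x] by (simp add: ring_of_type_algebra_def)

lemma scalar_smult_zero_right [simp]: "c \<odot> \<zero> = \<zero>"
  using smult_r_null[of c] by (simp add: ring_of_type_algebra_def)

lemma scalar_smult_minus_one:
  assumes "x \<in> carrier M"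
  shows "\<ominus> x = (- 1) \<odot> x"
proof (rule M.minus_equality)
  show "(- 1) \<odot> x \<oplus> x = \<zero>"
    using scalar_smult_add_left[of x "- 1" 1] assms by simp
qed (use assms in auto)

lemma smult_eq_zero_imp:
  assumes "x \<in> carrier M" "c \<noteq> 0" "c \<odot> x = \<zero>"
  shows "x = \<zero>"
  using scalar_smult_assoc[of x "1 / c" c] assms by simp

lemma add_eq_zero_imp_eq:
  assumes "x \<in> carrier M" "y \<in> carrier M" "x \<oplus> y = \<zero>"
  shows "x = (- 1) \<odot> y"
  using assms M.minus_equality scalar_smult_minus_one by metis

text \<open>With \<open>finsum_combination_single\<close>, this adds one multiple of a spanning
  vector to a combination over a fixed index set, as the spanning argument for quotients
  requires.\<close>

lemma finsum_combination_add:
  assumes "T \<subseteq> carrier M"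
  shows "(\<Oplus>t\<in>T. a t \<odot> t) \<oplus> (\<Oplus>t\<in>T. b t \<odot> t) = (\<Oplus>t\<in>T. (a t + b t) \<odot> t)"
proof -
  have "(\<Oplus>t\<in>T. (a t + b t) \<odot> t) = (\<Oplus>t\<in>T. a t \<odot> t \<oplus> b t \<odot> t)"
    using assms by (intro M.finsum_cong') (auto simp: scalar_smult_add_left)
  also have "\<dots> = (\<Oplus>t\<in>T. a t \<odot> t) \<oplus> (\<Oplus>t\<in>T. b t \<odot> t)"
    using assms by (intro M.finsum_addf) auto
  finally show ?thesis ..
qed

lemma finsum_combination_single:
  assumes "finite T" "T \<subseteq> carrier M" "u \<in> T"
  shows "(\<Oplus>t\<in>T. (if u = t then a else 0) \<odot> t) = a \<odot> u"
proof -
  have "(\<Oplus>t\<in>T. (if u = t then a else 0) \<odot> t) = (\<Oplus>t\<in>T. if u = t then a \<odot> t else \<zero>)"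
    using assms by (intro M.finsum_cong') auto
  also have "\<dots> = a \<odot> u"
    using assms by (intro M.finsum_singleton) auto
  finally show ?thesis .
qed

end

section \<open>Homogeneous components and reduction to homogeneous arguments\<close>

sublocale superalgebra \<subseteq> complex_module A ..

context superalgebra
begin

declare mult_closed [simp, intro]

lemma mult_zero_left [simp]: "x \<in> carrier A \<Longrightarrow> \<zero> \<otimes> x = \<zero>"
  using mult_smult_left[of \<zero> x 0] by simp

lemma mult_zero_right [simp]: "x \<in> carrier A \<Longrightarrow> x \<otimes> \<zero> = \<zero>"
  using mult_smult_right[of x \<zero> 0] by simp

lemma homog_carrier [intro]: "x \<in> homog A i \<Longrightarrow> x \<in> carrier A"
  using submoduleE(1)[OF homog_submodule] by blast

lemma homog_zero [simp]: "\<zero> \<in> homog A i"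
  using homog_submodule[of i] subgroup.one_closed[of "homog A i" "add_monoid A"]
  by (simp add: submodule_def)

lemma homog_add: "\<lbrakk>x \<in> homog A i; y \<in> homog A i\<rbrakk> \<Longrightarrow> x \<oplus> y \<in> homog A i"
  using submoduleE(5)[OF homog_submodule] by blast

lemma homog_smult: "x \<in> homog A i \<Longrightarrow> c \<odot> x \<in> homog A i"
  using submoduleE(4)[OF homog_submodule] by (simp add: ring_of_type_algebra_def)

text \<open>Since x = -y, the element x lies in both components, which meet only in zero. Writing
  the other degree as \<open>i + 1\<close> treats both parities at once.\<close>

lemma homog_sum_zero:
  assumes x: "x \<in> homog A i" and y: "y \<in> homog A (i + 1)" and sum: "x \<oplus> y = \<zero>"
  shows "x = \<zero>" "y = \<zero>"
proof -
  note [simp] = x[THEN homog_carrier] y[THEN homog_carrier]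
  have "x = (- 1) \<odot> y"
    using sum by (intro add_eq_zero_imp_eq) auto
  then have "x \<in> homog A (i + 1)"
    using y homog_smult by simp
  with x have "x \<in> homog A 0 \<inter> homog A 1"
    by (cases i) auto
  then show "x = \<zero>" using homog_Int by simp
  then show "y = \<zero>" using sum by simp
qed

lemma homog_decompose_unique:
  assumes x: "x0 \<in> homog A 0" "x1 \<in> homog A 1" and y: "y0 \<in> homog A 0" "y1 \<in> homog A 1"
    and eq: "x0 \<oplus> x1 = y0 \<oplus> y1"
  shows "x0 = y0" "x1 = y1"
proof -
  note [simp] = x[THEN homog_carrier] y[THEN homog_carrier]
  have "(x0 \<oplus> \<ominus> y0) \<oplus> (x1 \<oplus> \<ominus> y1) = (x0 \<oplus> x1) \<oplus> \<ominus> (y0 \<oplus> y1)"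
    by (simp add: M.minus_add M.a_ac)
  also have "\<dots> = \<zero>"
    by (simp add: eq M.r_neg)
  finally have *: "(x0 \<oplus> \<ominus> y0) \<oplus> (x1 \<oplus> \<ominus> y1) = \<zero>" .
  \<comment> \<open>The differences of the even and of the odd parts sum to zero. The second degree
    is written \<open>0 + 1\<close> to fit \<open>homog_sum_zero\<close>.\<close>
  have "x0 \<oplus> \<ominus> y0 \<in> homog A 0" "x1 \<oplus> \<ominus> y1 \<in> homog A (0 + 1)"
    using x y by (simp_all add: scalar_smult_minus_one homog_add homog_smult)
  from homog_sum_zero[OF this *] show "x0 = y0" "x1 = y1"
    using M.minus_equality[of x0 "\<ominus> y0"] M.minus_equality[of x1 "\<ominus> y1"] by simp_all
qed

lemma homog_decompose:
  assumes "x \<in> carrier A"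
  obtains x0 x1 where "x0 \<in> homog A 0" "x1 \<in> homog A 1" "x = x0 \<oplus> x1"
  using assms homog_sum[symmetric] by (auto simp: set_add_def')

lemma homog_induct [consumes 1, case_names homog add]:
  assumes "x \<in> carrier A"
    and "\<And>i x. x \<in> homog A i \<Longrightarrow> P x"
    and "\<And>x y. \<lbrakk>x \<in> carrier A; y \<in> carrier A; P x; P y\<rbrakk> \<Longrightarrow> P (x \<oplus> y)"
  shows "P x"
  using assms(1) by (rule homog_decompose) (auto intro: assms)

text \<open>The signed identities apply only to homogeneous elements; this carries their
  consequences to arbitrary ones. Homogeneity is dropped one argument at a time, from the last to
  the first, by \<open>homog_induct\<close>.\<close>

lemma four_linear_zero:
  assumes homog: "\<And>i j k l x y z t. \<lbrakk>x \<in> homog A i; y \<in> homog A j; z \<in> homog A k; t \<in> homog A l\<rbrakk>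
      \<Longrightarrow> f x y z t = \<zero>"
    and add1: "\<And>x x' y z t. \<lbrakk>x \<in> carrier A; x' \<in> carrier A; y \<in> carrier A; z \<in> carrier A; t \<in> carrier A\<rbrakk>
      \<Longrightarrow> f (x \<oplus> x') y z t = f x y z t \<oplus> f x' y z t"
    and add2: "\<And>x y y' z t. \<lbrakk>x \<in> carrier A; y \<in> carrier A; y' \<in> carrier A; z \<in> carrier A; t \<in> carrier A\<rbrakk>
      \<Longrightarrow> f x (y \<oplus> y') z t = f x y z t \<oplus> f x y' z t"
    and add3: "\<And>x y z z' t. \<lbrakk>x \<in> carrier A; y \<in> carrier A; z \<in> carrier A; z' \<in> carrier A; t \<in> carrier A\<rbrakk>
      \<Longrightarrow> f x y (z \<oplus> z') t = f x y z t \<oplus> f x y z' t"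
    and add4: "\<And>x y z t t'. \<lbrakk>x \<in> carrier A; y \<in> carrier A; z \<in> carrier A; t \<in> carrier A; t' \<in> carrier A\<rbrakk>
      \<Longrightarrow> f x y z (t \<oplus> t') = f x y z t \<oplus> f x y z t'"
    and "x \<in> carrier A" "y \<in> carrier A" "z \<in> carrier A" "t \<in> carrier A"
  shows "f x y z t = \<zero>"
proof -
  have 1: "f x y z t = \<zero>"
    if "x \<in> homog A i" "y \<in> homog A j" "z \<in> homog A k" "t \<in> carrier A" for i j k x y z t
    using that(4)
  proof (induction t rule: homog_induct)
    case (add t t')
    then show ?case using that add4[of x y z t t'] by (simp add: homog_carrier)
  qed (use that homog in blast)
  have 2: "f x y z t = \<zero>"
    if "x \<in> homog A i" "y \<in> homog A j" "z \<in> carrier A" "t \<in> carrier A" for i j x y z t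
    using that(3)
  proof (induction z rule: homog_induct)
    case (add z z')
    then show ?case using that add3[of x y z z' t] by (simp add: homog_carrier)
  qed (use that 1 in blast)
  have 3: "f x y z t = \<zero>"
    if "x \<in> homog A i" "y \<in> carrier A" "z \<in> carrier A" "t \<in> carrier A" for i x y z t
    using that(2)
  proof (induction y rule: homog_induct)
    case (add y y')
    then show ?case using that add2[of x y y' z t] by (simp add: homog_carrier)
  qed (use that 2 in blast)
  show ?thesis
    using \<open>x \<in> carrier A\<close>
  proof (induction x rule: homog_induct)
    case (add x x')
    then show ?case using assms(7-9) add1[of x x' y z t] by simp
  qed (use assms(7-9) 3 in blast)
qed

end

section \<open>Symmetries and vanishing of nested products\<close>

context symmetric_zinbiel_superalgebra
begin

text \<open>The right identity writes y (x z) as (y x) z plus a signed (x y) z, and the left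
  identity writes (y x) z as y (x z) plus a signed y (z x). Substituting, y (x z) cancels.\<close>

lemma left_to_right_nested:
  assumes x: "x \<in> homog A i" and y: "y \<in> homog A j" and z: "z \<in> homog A k"
  shows "(x \<otimes> y) \<otimes> z = (- (super_sign i j * super_sign i k)) \<odot> (y \<otimes> (z \<otimes> x))"
proof -
  note [simp] = x[THEN homog_carrier] y[THEN homog_carrier] z[THEN homog_carrier]
  define s where "s = super_sign i j"
  define r where "r = super_sign i k"
  define p where "p = y \<otimes> (x \<otimes> z)"
  define q where "q = y \<otimes> (z \<otimes> x)"
  define v where "v = (x \<otimes> y) \<otimes> z"
  have [simp]: "p \<in> carrier A" "q \<in> carrier A" "v \<in> carrier A"
    by (simp_all add: p_def q_def v_def)
  have "p = p \<oplus> r \<odot> q \<oplus> s \<odot> v"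
    using left_zinbiel[OF y x z] right_zinbiel[OF y x z]
    by (simp add: p_def q_def v_def s_def r_def super_sign_commute)
  then have "p \<oplus> (r \<odot> q \<oplus> s \<odot> v) = p \<oplus> \<zero>"
    using M.a_assoc[of p "r \<odot> q" "s \<odot> v"] by simp
  then have "r \<odot> q \<oplus> s \<odot> v = \<zero>"
    by (rule M.add.l_cancel) simp_all
  then have "s \<odot> v \<oplus> r \<odot> q = \<zero>"
    by (simp add: M.a_comm)
  then have "s \<odot> v = (- r) \<odot> q"
    by (subst add_eq_zero_imp_eq[of "s \<odot> v" "r \<odot> q"]) (simp_all add: scalar_smult_assoc)
  \<comment> \<open>Since \<open>s\<close> squares to 1, multiplying by \<open>s\<close> isolates
    \<open>v\<close>.\<close>
  then have "s \<odot> (s \<odot> v) = s \<odot> ((- r) \<odot> q)"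
    by simp
  then show ?thesis
    by (simp add: scalar_smult_assoc s_def r_def v_def q_def)
qed

text \<open>Up to a sign, the right-hand side of the left identity does not change when its last two
  factors are exchanged, so (z y) x and (z x) y agree up to sign.
  \<open>left_to_right_nested\<close> turns them into y (x z) and x (y z).\<close>

lemma right_nested_left_commute:
  assumes x: "x \<in> homog A i" and y: "y \<in> homog A j" and z: "z \<in> homog A k"
  shows "x \<otimes> (y \<otimes> z) = super_sign i j \<odot> (y \<otimes> (x \<otimes> z))"
proof -
  note [simp] = x[THEN homog_carrier] y[THEN homog_carrier] z[THEN homog_carrier]
  have "(z \<otimes> y) \<otimes> x = super_sign i j \<odot> ((z \<otimes> x) \<otimes> y)"
    using left_zinbiel[OF z x y] left_zinbiel[OF z y x]
    by (simp add: super_sign_commute[of j i] scalar_smult_add_right scalar_smult_assoc M.a_comm)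
  \<comment> \<open>Both sides carry the sign \<open>super_sign k i * super_sign k j\<close> from
    moving z; multiplying by it once more removes it.\<close>
  then have "(super_sign k i * super_sign k j) \<odot> ((- (super_sign k j * super_sign k i)) \<odot> (y \<otimes> (x \<otimes> z)))
     = (super_sign k i * super_sign k j) \<odot> (super_sign i j \<odot> ((- (super_sign k i * super_sign k j)) \<odot> (x \<otimes> (y \<otimes> z))))"
    by (simp add: left_to_right_nested[OF z x y] left_to_right_nested[OF z y x])
  then have "(- 1) \<odot> (y \<otimes> (x \<otimes> z)) = (- super_sign i j) \<odot> (x \<otimes> (y \<otimes> z))"
    by (cases i; cases j; cases k; simp add: scalar_smult_assoc super_sign_def)
  then have "(- super_sign i j) \<odot> ((- 1) \<odot> (y \<otimes> (x \<otimes> z))) = (- super_sign i j) \<odot> ((- super_sign i j) \<odot> (x \<otimes> (y \<otimes> z)))"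
    by simp
  then show ?thesis
    by (simp add: scalar_smult_assoc)
qed

text \<open>By the left identity the first two terms sum to (x y) z, which
  \<open>left_to_right_nested\<close> identifies as the negative of the third.\<close>

lemma right_nested_cyclic:
  assumes x: "x \<in> homog A i" and y: "y \<in> homog A j" and z: "z \<in> homog A k"
  shows "x \<otimes> (y \<otimes> z) \<oplus> super_sign j k \<odot> (x \<otimes> (z \<otimes> y))
    \<oplus> (super_sign i j * super_sign i k) \<odot> (y \<otimes> (z \<otimes> x)) = \<zero>"
proof -
  note [simp] = x[THEN homog_carrier] y[THEN homog_carrier] z[THEN homog_carrier]
  show ?thesis
    using left_zinbiel[OF x y z, symmetric] left_to_right_nested[OF x y z]
      scalar_smult_add_left[of "y \<otimes> (z \<otimes> x)" "- (super_sign i j * super_sign i k)" "super_sign i j * super_sign i k"]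
    by simp
qed

text \<open>Two instances of the cyclic identity are compared: x times the one for y, z, t and, up
  to sign, y times the one for x, z, t. Their first two terms form the same element
  \<open>?u\<close>, so the third terms agree.\<close>

lemma right_nested_swap_outer:
  assumes x: "x \<in> homog A i" and y: "y \<in> homog A j" and z: "z \<in> homog A k" and t: "t \<in> homog A l"
  shows "(super_sign j k * super_sign j l) \<odot> (x \<otimes> (z \<otimes> (t \<otimes> y)))
    = (super_sign i j * super_sign i k * super_sign i l) \<odot> (y \<otimes> (z \<otimes> (t \<otimes> x)))"
proof -
  note [simp] = x[THEN homog_carrier] y[THEN homog_carrier] z[THEN homog_carrier] t[THEN homog_carrier]
  let ?u = "x \<otimes> (y \<otimes> (z \<otimes> t)) \<oplus> super_sign k l \<odot> (x \<otimes> (y \<otimes> (t \<otimes> z)))"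
  \<comment> \<open>Here z t and t z act as single homogeneous factors, of degrees supplied by
    \<open>mult_homog\<close>.\<close>
  have *: "x \<otimes> (y \<otimes> (z \<otimes> t)) = super_sign i j \<odot> (y \<otimes> (x \<otimes> (z \<otimes> t)))"
      "x \<otimes> (y \<otimes> (t \<otimes> z)) = super_sign i j \<odot> (y \<otimes> (x \<otimes> (t \<otimes> z)))"
    by (rule right_nested_left_commute[OF x y mult_homog] z t)+
  have "?u \<oplus> (super_sign j k * super_sign j l) \<odot> (x \<otimes> (z \<otimes> (t \<otimes> y)))
     = x \<otimes> (y \<otimes> (z \<otimes> t) \<oplus> super_sign k l \<odot> (y \<otimes> (t \<otimes> z))
      \<oplus> (super_sign j k * super_sign j l) \<odot> (z \<otimes> (t \<otimes> y)))"
    by (simp add: mult_add_right mult_smult_right)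
  also have "\<dots> = \<zero>"
    by (simp add: right_nested_cyclic[OF y z t])
  finally have 1: "?u \<oplus> (super_sign j k * super_sign j l) \<odot> (x \<otimes> (z \<otimes> (t \<otimes> y))) = \<zero>" .
  have "?u \<oplus> (super_sign i j * super_sign i k * super_sign i l) \<odot> (y \<otimes> (z \<otimes> (t \<otimes> x)))
     = super_sign i j \<odot> (y \<otimes> (x \<otimes> (z \<otimes> t) \<oplus> super_sign k l \<odot> (x \<otimes> (t \<otimes> z))
      \<oplus> (super_sign i k * super_sign i l) \<odot> (z \<otimes> (t \<otimes> x))))"
    by (simp add: * mult_add_right mult_smult_right scalar_smult_add_right scalar_smult_assoc mult_ac)
  also have "\<dots> = \<zero>"
    by (simp add: right_nested_cyclic[OF x z t])
  finally have 2: "?u \<oplus> (super_sign i j * super_sign i k * super_sign i l) \<odot> (y \<otimes> (z \<otimes> (t \<otimes> x))) = \<zero>" .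
  show ?thesis
    using trans[OF 1 2[symmetric]] by (rule M.add.l_cancel) simp_all
qed

text \<open>The third factor is moved to the front, exchanged there with the last one by
  \<open>right_nested_swap_outer\<close>, and the new front factor is moved back.\<close>

lemma right_nested_swap_inner:
  assumes x: "x \<in> homog A i" and y: "y \<in> homog A j" and z: "z \<in> homog A k" and t: "t \<in> homog A l"
  shows "x \<otimes> (y \<otimes> (t \<otimes> z)) = super_sign k l \<odot> (x \<otimes> (y \<otimes> (z \<otimes> t)))"
proof -
  note [simp] = x[THEN homog_carrier] y[THEN homog_carrier] z[THEN homog_carrier] t[THEN homog_carrier]
  \<comment> \<open>Stated for fresh z and t because it is used in both orders, once for each side
    of the goal.\<close>
  have front: "x \<otimes> (y \<otimes> (t \<otimes> z)) = (super_sign i l * super_sign j l) \<odot> (t \<otimes> (x \<otimes> (y \<otimes> z)))"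
    if z: "z \<in> homog A k" and t: "t \<in> homog A l" for z t k l
  proof -
    note [simp] = z[THEN homog_carrier] t[THEN homog_carrier]
    have "x \<otimes> (y \<otimes> (t \<otimes> z)) = super_sign j l \<odot> (x \<otimes> (t \<otimes> (y \<otimes> z)))"
      by (simp add: right_nested_left_commute[OF y t z] mult_smult_right)
    also have "\<dots> = super_sign j l \<odot> (super_sign i l \<odot> (t \<otimes> (x \<otimes> (y \<otimes> z))))"
      by (simp only: right_nested_left_commute[OF x t mult_homog[OF y z]])
    finally show ?thesis by (simp add: scalar_smult_assoc mult_ac)
  qed
  have "(super_sign i k * super_sign j k) \<odot> (t \<otimes> (x \<otimes> (y \<otimes> z)))
     = (super_sign k l * super_sign i l * super_sign j l) \<odot> (z \<otimes> (x \<otimes> (y \<otimes> t)))"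
    using right_nested_swap_outer[OF t z x y] by (simp add: super_sign_commute mult_ac)
  then have "(super_sign i k * super_sign j k) \<odot> ((super_sign i k * super_sign j k) \<odot> (t \<otimes> (x \<otimes> (y \<otimes> z))))
     = (super_sign i k * super_sign j k) \<odot> ((super_sign k l * super_sign i l * super_sign j l) \<odot> (z \<otimes> (x \<otimes> (y \<otimes> t))))"
    by simp
  then show ?thesis
    unfolding front[OF z t] front[OF t z]
    \<comment> \<open>What remains is an identity of signs, settled by running through all
      parities.\<close>
    by (cases i; cases j; cases k; cases l; simp add: scalar_smult_assoc super_sign_def)
qed

text \<open>By the symmetries, each of the three terms of x times the cyclic identity for y, z, t,
  taken with its sign, equals \<open>p\<close>. Hence three times \<open>p\<close> is zero, and 3 is
  invertible.\<close>

lemma right_nested_4_zero: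
  assumes x: "x \<in> homog A i" and y: "y \<in> homog A j" and z: "z \<in> homog A k" and t: "t \<in> homog A l"
  shows "x \<otimes> (y \<otimes> (z \<otimes> t)) = \<zero>"
proof -
  note [simp] = x[THEN homog_carrier] y[THEN homog_carrier] z[THEN homog_carrier] t[THEN homog_carrier]
  define p where "p = x \<otimes> (y \<otimes> (z \<otimes> t))"
  have [simp]: "p \<in> carrier A" by (simp add: p_def)
  have "super_sign k l \<odot> (x \<otimes> (y \<otimes> (t \<otimes> z))) = p"
    by (simp add: right_nested_swap_inner[OF x y z t] scalar_smult_assoc p_def)
  moreover have "(super_sign j k * super_sign j l) \<odot> (x \<otimes> (z \<otimes> (t \<otimes> y))) = p"
  proof -
    \<comment> \<open>An inner swap turns z (t y) into z (y t), up to sign; then y is moved past z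
      inside the product with x.\<close>
    have "x \<otimes> (z \<otimes> (t \<otimes> y)) = super_sign j l \<odot> (super_sign j k \<odot> p)"
      by (simp add: right_nested_swap_inner[OF x z y t] p_def mult_smult_right
          right_nested_left_commute[OF z y t] super_sign_commute[of k j])
    then show ?thesis
      by (cases j; cases k; cases l; simp add: scalar_smult_assoc super_sign_def)
  qed
  moreover have "p \<oplus> super_sign k l \<odot> (x \<otimes> (y \<otimes> (t \<otimes> z)))
      \<oplus> (super_sign j k * super_sign j l) \<odot> (x \<otimes> (z \<otimes> (t \<otimes> y)))
    = x \<otimes> (y \<otimes> (z \<otimes> t) \<oplus> super_sign k l \<odot> (y \<otimes> (t \<otimes> z))
      \<oplus> (super_sign j k * super_sign j l) \<odot> (z \<otimes> (t \<otimes> y)))"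
    by (simp add: mult_add_right mult_smult_right p_def)
  ultimately have "p \<oplus> p \<oplus> p = \<zero>"
    by (simp add: right_nested_cyclic[OF y z t])
  then have "3 \<odot> p = \<zero>"
    using scalar_smult_add_left[of p 1 1] scalar_smult_add_left[of p 2 1] by simp
  then show ?thesis
    using smult_eq_zero_imp[of p 3] by (simp add: p_def)
qed

lemma mult_4_zero:
  assumes x: "x \<in> carrier A" and y: "y \<in> carrier A" and z: "z \<in> carrier A" and t: "t \<in> carrier A"
  shows "(x \<otimes> y) \<otimes> (z \<otimes> t) = \<zero>"
    and "x \<otimes> ((y \<otimes> z) \<otimes> t) = \<zero>"
    and "x \<otimes> (y \<otimes> (z \<otimes> t)) = \<zero>"
    and "((x \<otimes> y) \<otimes> z) \<otimes> t = \<zero>"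
    and "(x \<otimes> (y \<otimes> z)) \<otimes> t = \<zero>"
proof -
  note [simp] = mult_add_left mult_add_right mult_smult_right homog_carrier
  have 1: "x \<otimes> (y \<otimes> (z \<otimes> t)) = \<zero>"
    if x: "x \<in> carrier A" and y: "y \<in> carrier A" and z: "z \<in> carrier A" and t: "t \<in> carrier A" for x y z t
    by (rule four_linear_zero[of "\<lambda>x y z t. x \<otimes> (y \<otimes> (z \<otimes> t))", OF right_nested_4_zero])
      (simp_all add: that)
  then show "x \<otimes> (y \<otimes> (z \<otimes> t)) = \<zero>"
    by (simp add: assms)
  \<comment> \<open>A rotation rule: a left-nested product vanishes as soon as its rotated
    right-nested form does. Each remaining bracketing is rotated until \<open>1\<close> or
    \<open>mid\<close> applies.\<close>
  have left: "(x \<otimes> y) \<otimes> w = \<zero>"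
    if "x \<in> homog A i" "y \<in> homog A j" "w \<in> homog A k" "y \<otimes> (w \<otimes> x) = \<zero>" for x y w i j k
    using left_to_right_nested[OF that(1-3)] that(4) by simp
  have mid: "x \<otimes> ((y \<otimes> z) \<otimes> t) = \<zero>"
    if "x \<in> homog A i" "y \<in> homog A j" "z \<in> homog A k" "t \<in> homog A l" for x y z t i j k l
    using left_to_right_nested[OF that(2-4)] that 1 by simp
  show "x \<otimes> ((y \<otimes> z) \<otimes> t) = \<zero>"
    by (rule four_linear_zero[of "\<lambda>x y z t. x \<otimes> ((y \<otimes> z) \<otimes> t)", OF mid]) (simp_all add: assms)
  \<comment> \<open>Rotation gives y ((z t) x), which is of the form treated in
    \<open>mid\<close>.\<close>
  show "(x \<otimes> y) \<otimes> (z \<otimes> t) = \<zero>"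
    by (rule four_linear_zero[of "\<lambda>x y z t. (x \<otimes> y) \<otimes> (z \<otimes> t)"], rule left[OF _ _ mult_homog])
      (simp_all add: assms mid)
  show "(x \<otimes> (y \<otimes> z)) \<otimes> t = \<zero>"
  proof (rule four_linear_zero[of "\<lambda>x y z t. (x \<otimes> (y \<otimes> z)) \<otimes> t"])
    fix i j k l x y z t
    assume h: "x \<in> homog A i" "y \<in> homog A j" "z \<in> homog A k" "t \<in> homog A l"
    \<comment> \<open>Two rotations are needed: (x (y z)) t leads to (y z) (t x), and this to z ((t
      x) y), to which \<open>mid\<close> applies.\<close>
    have "(y \<otimes> z) \<otimes> (t \<otimes> x) = \<zero>"
      using left[OF h(2,3) mult_homog[OF h(4,1)]] mid h by simp
    then show "(x \<otimes> (y \<otimes> z)) \<otimes> t = \<zero>"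
      by (rule left[OF h(1) mult_homog[OF h(2,3)] h(4)])
  qed (simp_all add: assms)
  show "((x \<otimes> y) \<otimes> z) \<otimes> t = \<zero>"
  proof (rule four_linear_zero[of "\<lambda>x y z t. ((x \<otimes> y) \<otimes> z) \<otimes> t"])
    fix i j k l x y z t
    assume h: "x \<in> homog A i" "y \<in> homog A j" "z \<in> homog A k" "t \<in> homog A l"
    then show "((x \<otimes> y) \<otimes> z) \<otimes> t = \<zero>"
      by (intro left[OF mult_homog[OF h(1,2)] h(3,4)]) (simp add: 1)
  qed (simp_all add: assms)
qed

text \<open>With all arguments equal, the two identities read q = s p and p = s q, where
  \<open>s\<close> is 2 for even x and 0 for odd x. So s s - 1 is 3 or -1, never zero, and it
  annihilates \<open>p\<close>.\<close>

lemma homog_cube_zero: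
  assumes x: "x \<in> homog A i"
  shows "(x \<otimes> x) \<otimes> x = \<zero>" and "x \<otimes> (x \<otimes> x) = \<zero>"
proof -
  note [simp] = x[THEN homog_carrier]
  define p where "p = x \<otimes> (x \<otimes> x)"
  define q where "q = (x \<otimes> x) \<otimes> x"
  define s where "s = 1 + super_sign i i"
  have [simp]: "p \<in> carrier A" "q \<in> carrier A" by (simp_all add: p_def q_def)
  have "q = s \<odot> p" "p = s \<odot> q"
    using left_zinbiel[OF x x x] right_zinbiel[OF x x x]
    by (simp_all add: p_def q_def s_def scalar_smult_add_left)
  moreover have "p = \<zero>"
  proof (rule smult_eq_zero_imp)
    have "(s * s) \<odot> p = p"
      using calculation by (metis \<open>p \<in> carrier A\<close> scalar_smult_assoc)
    then show "(s * s - 1) \<odot> p = \<zero>"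
      using scalar_smult_add_left[of p "s * s" "- 1"] M.r_neg[of p] by (simp add: scalar_smult_minus_one)
    show "s * s - 1 \<noteq> 0" by (auto simp: s_def super_sign_def)
  qed simp
  ultimately show "(x \<otimes> x) \<otimes> x = \<zero>" and "x \<otimes> (x \<otimes> x) = \<zero>"
    by (simp_all add: p_def q_def)
qed

end


section \<open>The quotient superalgebra by a graded ideal\<close>

locale superalgebra_graded_ideal = superalgebra +
  fixes I :: "'a set"
  assumes graded_ideal: "graded_ideal I A"
begin

sublocale I: abelian_subgroup I A
proof (intro abelian_subgroupI3 additive_subgroup.intro)
  show "subgroup I (add_monoid A)"
    using graded_ideal by (auto simp: graded_ideal_def submodule_def)
  show "abelian_group A" ..
qed

lemma ideal_smult: "a \<in> I \<Longrightarrow> c \<odot> a \<in> I"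
  using graded_ideal submoduleE(4)[of I] by (simp add: graded_ideal_def ring_of_type_algebra_def)

lemma ideal_mult: "\<lbrakk>a \<in> I; x \<in> carrier A\<rbrakk> \<Longrightarrow> a \<otimes> x \<in> I" "\<lbrakk>a \<in> I; x \<in> carrier A\<rbrakk> \<Longrightarrow> x \<otimes> a \<in> I"
  using graded_ideal by (auto simp: graded_ideal_def)

lemma ideal_decompose:
  assumes "a \<in> I"
  obtains a0 a1 where "a0 \<in> I" "a0 \<in> homog A 0" "a1 \<in> I" "a1 \<in> homog A 1" "a = a0 \<oplus> a1"
proof -
  have "a \<in> set_add A (I \<inter> homog A 0) (I \<inter> homog A 1)"
    using assms graded_ideal by (simp add: graded_ideal_def)
  then obtain a0 a1 where "a0 \<in> I \<inter> homog A 0" "a1 \<in> I \<inter> homog A 1" "a = a0 \<oplus> a1"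
    unfolding set_add_def' by blast
  with that show ?thesis
    by blast
qed

abbreviation Q :: "'a set superalgebra"
  where "Q \<equiv> quotient_superalgebra A I"

abbreviation proj :: "'a \<Rightarrow> 'a set"
  where "proj x \<equiv> I +> x"

lemma carrier_quotient: "carrier Q = proj ` carrier A"
  by (auto simp: quotient_superalgebra_def A_RCOSETS_def')

lemma homog_quotient: "homog Q i = proj ` homog A i"
  by (simp add: quotient_superalgebra_def)

lemma proj_closed [simp, intro]: "x \<in> carrier A \<Longrightarrow> proj x \<in> carrier Q"
  by (simp add: carrier_quotient)

lemma mem_proj_iff: "u \<in> proj x \<longleftrightarrow> (\<exists>a\<in>I. u = a \<oplus> x)"
  by (auto simp: a_r_coset_def')

lemma proj_eqI: "\<lbrakk>a \<in> I; x \<in> carrier A\<rbrakk> \<Longrightarrow> proj (a \<oplus> x) = proj x"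
  using I.a_repr_independence'[of "a \<oplus> x" x] by (auto simp: mem_proj_iff)

lemma proj_eqD:
  assumes "proj x = proj y" "x \<in> carrier A"
  obtains a where "a \<in> I" "x = a \<oplus> y"
  using assms I.a_rcos_self[of x] by (auto simp: mem_proj_iff)

lemma zero_quotient: "\<zero>\<^bsub>Q\<^esub> = I"
  by (simp add: quotient_superalgebra_def)

lemma proj_zero [simp]: "proj \<zero> = \<zero>\<^bsub>Q\<^esub>"
  by (simp add: zero_quotient I.a_rcos_const)

lemma proj_eq_zero_iff:
  assumes "x \<in> carrier A"
  shows "proj x = \<zero>\<^bsub>Q\<^esub> \<longleftrightarrow> x \<in> I"
  using assms I.a_rcos_self[of x] I.a_rcos_const[of x] by (auto simp: zero_quotient)

lemma proj_add: "\<lbrakk>x \<in> carrier A; y \<in> carrier A\<rbrakk> \<Longrightarrow> proj x \<oplus>\<^bsub>Q\<^esub> proj y = proj (x \<oplus> y)"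
  by (simp add: quotient_superalgebra_def I.a_rcos_sum)

text \<open>Scaling in the quotient is a union over all representatives. By
  \<open>ideal_smult\<close> every member of that union is the same coset, and the union is nonempty
  because x represents its own class.\<close>

lemma proj_smult:
  assumes x: "x \<in> carrier A"
  shows "c \<odot>\<^bsub>Q\<^esub> proj x = proj (c \<odot> x)"
proof -
  have "proj (c \<odot> u) = proj (c \<odot> x)" if "u \<in> proj x" for u
    using that x by (auto simp: mem_proj_iff scalar_smult_add_right proj_eqI ideal_smult)
  with I.a_rcos_self[OF x] have "(\<Union>u\<in>proj x. proj (c \<odot> u)) = proj (c \<odot> x)"
    by (intro UN_constant_eq ballI)
  then show ?thesis
    by (simp add: quotient_superalgebra_def)
qed

lemma proj_mult:
  assumes x: "x \<in> carrier A" and y: "y \<in> carrier A"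
  shows "proj x \<otimes>\<^bsub>Q\<^esub> proj y = proj (x \<otimes> y)"
proof -
  have "proj (u \<otimes> v) = proj (x \<otimes> y)" if "u \<in> proj x" "v \<in> proj y" for u v
  proof -
    from that obtain a b where ab: "a \<in> I" "u = a \<oplus> x" "b \<in> I" "v = b \<oplus> y"
      by (auto simp: mem_proj_iff)
    \<comment> \<open>Changing representatives alters the product by a v + x b, which lies in the
      two-sided ideal.\<close>
    then have "u \<otimes> v = (a \<otimes> v \<oplus> x \<otimes> b) \<oplus> x \<otimes> y"
      using x y by (simp add: mult_add_left mult_add_right M.a_ac)
    then show ?thesis
      using ab x y by (simp add: ideal_mult proj_eqI)
  qed
  with I.a_rcos_self[OF x] I.a_rcos_self[OF y]
  have "(\<Union>u\<in>proj x. \<Union>v\<in>proj y. proj (u \<otimes> v)) = proj (x \<otimes> y)"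
    by (intro UN_constant_eq ballI)
  then show ?thesis
    by (simp add: quotient_superalgebra_def rcoset_mult_def)
qed

lemma abelian_group_quotient: "abelian_group Q"
proof (rule abelian_groupI)
  show "\<zero>\<^bsub>Q\<^esub> \<in> carrier Q"
    by (metis M.zero_closed proj_closed proj_zero)
  fix u assume u: "u \<in> carrier Q"
  then obtain x where x: "x \<in> carrier A" "u = proj x" by (auto simp: carrier_quotient)
  then show "\<exists>v\<in>carrier Q. v \<oplus>\<^bsub>Q\<^esub> u = \<zero>\<^bsub>Q\<^esub>"
    by (intro bexI[of _ "proj (\<ominus> x)"]) (simp_all add: proj_add M.l_neg)
  show "\<zero>\<^bsub>Q\<^esub> \<oplus>\<^bsub>Q\<^esub> u = u"
    using proj_add[OF M.zero_closed] x by simp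
  fix v assume v: "v \<in> carrier Q"
  show "u \<oplus>\<^bsub>Q\<^esub> v \<in> carrier Q" "u \<oplus>\<^bsub>Q\<^esub> v = v \<oplus>\<^bsub>Q\<^esub> u"
    using u v by (auto simp: carrier_quotient proj_add M.a_comm)
  fix w assume "w \<in> carrier Q"
  with u v show "(u \<oplus>\<^bsub>Q\<^esub> v) \<oplus>\<^bsub>Q\<^esub> w = u \<oplus>\<^bsub>Q\<^esub> (v \<oplus>\<^bsub>Q\<^esub> w)"
    by (auto simp: carrier_quotient proj_add M.a_assoc)
qed

lemma module_quotient: "module complex_ring Q"
proof (intro module.intro module_axioms.intro abelian_group_quotient)
  show "cring complex_ring" ..
next
  fix a u assume "u \<in> carrier Q"
  then show "a \<odot>\<^bsub>Q\<^esub> u \<in> carrier Q"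
    by (auto simp: carrier_quotient proj_smult)
next
  fix a b u assume "u \<in> carrier Q"
  then show "(a \<oplus>\<^bsub>complex_ring\<^esub> b) \<odot>\<^bsub>Q\<^esub> u = a \<odot>\<^bsub>Q\<^esub> u \<oplus>\<^bsub>Q\<^esub> b \<odot>\<^bsub>Q\<^esub> u"
    by (auto simp: carrier_quotient proj_smult proj_add scalar_smult_add_left ring_of_type_algebra_def)
next
  fix a u v assume "u \<in> carrier Q" "v \<in> carrier Q"
  then show "a \<odot>\<^bsub>Q\<^esub> (u \<oplus>\<^bsub>Q\<^esub> v) = a \<odot>\<^bsub>Q\<^esub> u \<oplus>\<^bsub>Q\<^esub> a \<odot>\<^bsub>Q\<^esub> v"
    by (auto simp: carrier_quotient proj_smult proj_add scalar_smult_add_right)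
next
  fix a b u assume "u \<in> carrier Q"
  then show "(a \<otimes>\<^bsub>complex_ring\<^esub> b) \<odot>\<^bsub>Q\<^esub> u = a \<odot>\<^bsub>Q\<^esub> (b \<odot>\<^bsub>Q\<^esub> u)"
    by (auto simp: carrier_quotient proj_smult scalar_smult_assoc ring_of_type_algebra_def)
next
  fix u assume "u \<in> carrier Q"
  then show "\<one>\<^bsub>complex_ring\<^esub> \<odot>\<^bsub>Q\<^esub> u = u"
    by (auto simp: carrier_quotient proj_smult ring_of_type_algebra_def)
qed

sublocale Q: complex_module Q
  by (rule complex_module.intro, rule module_quotient)

text \<open>The classes of a finite spanning set span the quotient. Distinct vectors may have the
  same class, so their coefficients have to be collected.\<close>

lemma quotient_finite_dimensional:
  "\<exists>S. finite S \<and> S \<subseteq> carrier Q \<and>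
     (\<forall>x \<in> carrier Q. \<exists>c :: 'a set \<Rightarrow> complex. x = (\<Oplus>\<^bsub>Q\<^esub>s\<in>S. c s \<odot>\<^bsub>Q\<^esub> s))"
proof -
  obtain S where S: "finite S" "S \<subseteq> carrier A"
    and span: "\<forall>x \<in> carrier A. \<exists>c :: 'a \<Rightarrow> complex. x = (\<Oplus>s\<in>S. c s \<odot> s)"
    using finite_dimensional by (elim exE conjE)
  let ?T = "proj ` S"
  have T: "finite ?T" "?T \<subseteq> carrier Q"
    using S by auto
  \<comment> \<open>The index set on the right stays \<open>?T\<close> while \<open>F\<close> grows:
    a new vector only changes the coefficient of its own class, even if that class occurred
    before.\<close>
  have proj_sum: "\<exists>c'. proj (\<Oplus>s\<in>F. c s \<odot> s) = (\<Oplus>\<^bsub>Q\<^esub>t\<in>?T. c' t \<odot>\<^bsub>Q\<^esub> t)"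
    if "F \<subseteq> S" for F :: "'a set" and c :: "'a \<Rightarrow> complex"
    using finite_subset[OF that S(1)] that
  proof (induction F rule: finite_induct)
    case empty
    have "(\<Oplus>\<^bsub>Q\<^esub>t\<in>?T. 0 \<odot>\<^bsub>Q\<^esub> t) = (\<Oplus>\<^bsub>Q\<^esub>t\<in>?T. \<zero>\<^bsub>Q\<^esub>)"
      using T by (intro Q.M.finsum_cong') auto
    then show ?case
      by (intro exI[of _ "\<lambda>_. 0"]) simp
  next
    case (insert s F)
    then obtain c' where c': "proj (\<Oplus>s\<in>F. c s \<odot> s) = (\<Oplus>\<^bsub>Q\<^esub>t\<in>?T. c' t \<odot>\<^bsub>Q\<^esub> t)"
      by auto
    have s: "s \<in> carrier A" "proj s \<in> ?T" and F: "(\<lambda>s. c s \<odot> s) \<in> F \<rightarrow> carrier A"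
      using insert S by auto
    have "proj (\<Oplus>s\<in>insert s F. c s \<odot> s) = proj (c s \<odot> s \<oplus> (\<Oplus>s\<in>F. c s \<odot> s))"
      using insert s F by (simp add: M.finsum_insert)
    also have "\<dots> = c s \<odot>\<^bsub>Q\<^esub> proj s \<oplus>\<^bsub>Q\<^esub> (\<Oplus>\<^bsub>Q\<^esub>t\<in>?T. c' t \<odot>\<^bsub>Q\<^esub> t)"
      using s F by (simp add: proj_smult M.finsum_closed flip: proj_add c')
    also have "\<dots> = (\<Oplus>\<^bsub>Q\<^esub>t\<in>?T. ((if proj s = t then c s else 0) + c' t) \<odot>\<^bsub>Q\<^esub> t)"
      using T s by (simp only: Q.finsum_combination_single[OF T s(2), symmetric]
          Q.finsum_combination_add[OF T(2)])
    finally show ?case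
      by (intro exI[of _ "\<lambda>t. (if proj s = t then c s else 0) + c' t"])
  qed
  have "\<exists>c. u = (\<Oplus>\<^bsub>Q\<^esub>t\<in>?T. c t \<odot>\<^bsub>Q\<^esub> t)" if u: "u \<in> carrier Q" for u
  proof -
    obtain x where "x \<in> carrier A" "u = proj x"
      using u unfolding carrier_quotient by blast
    moreover then obtain c where "x = (\<Oplus>s\<in>S. c s \<odot> s)"
      using span by blast
    ultimately show ?thesis
      using proj_sum[of S c] by simp
  qed
  with T show ?thesis
    by (intro exI[of _ ?T]) simp
qed

lemma zero_mem_homog_quotient: "\<zero>\<^bsub>Q\<^esub> \<in> homog Q i"
  unfolding homog_quotient proj_zero[symmetric] by (intro imageI homog_zero)

lemma quotient_homog_submodule: "submodule (homog Q i) complex_ring Q"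
proof (rule Q.submoduleI)
  show "homog Q i \<subseteq> carrier Q"
    by (auto simp: homog_quotient)
  show "\<zero>\<^bsub>Q\<^esub> \<in> homog Q i"
    by (rule zero_mem_homog_quotient)
  show "\<ominus>\<^bsub>Q\<^esub> u \<in> homog Q i" if u: "u \<in> homog Q i" for u
  proof -
    obtain x where x: "x \<in> homog A i" "u = proj x"
      using u by (auto simp: homog_quotient)
    have "\<ominus>\<^bsub>Q\<^esub> u = proj ((- 1) \<odot> x)"
      using x by (intro Q.M.minus_equality)
        (auto simp: proj_add homog_carrier M.l_neg simp flip: scalar_smult_minus_one)
    then show ?thesis
      using x by (simp add: homog_quotient homog_smult)
  qed
next
  fix u v assume "u \<in> homog Q i" "v \<in> homog Q i"
  then obtain x y where xy: "x \<in> homog A i" "u = proj x" "y \<in> homog A i" "v = proj y"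
    unfolding homog_quotient by blast
  then have "u \<oplus>\<^bsub>Q\<^esub> v = proj (x \<oplus> y)"
    by (simp add: proj_add homog_carrier)
  with homog_add[OF xy(1,3)] show "u \<oplus>\<^bsub>Q\<^esub> v \<in> homog Q i"
    unfolding homog_quotient by blast
next
  fix c u assume "u \<in> homog Q i"
  then obtain x where x: "x \<in> homog A i" "u = proj x"
    unfolding homog_quotient by blast
  then have "c \<odot>\<^bsub>Q\<^esub> u = proj (c \<odot> x)"
    by (simp add: proj_smult homog_carrier)
  with homog_smult[OF x(1)] show "c \<odot>\<^bsub>Q\<^esub> u \<in> homog Q i"
    unfolding homog_quotient by blast
qed

text \<open>This rests on the ideal being graded. If an even x0 and an odd x1 have the same class,
  their difference in \<open>I\<close> splits into parts a0 and a1 in \<open>I\<close>; comparing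
  even parts gives x0 = a0.\<close>

lemma quotient_homog_Int: "homog Q 0 \<inter> homog Q 1 = {\<zero>\<^bsub>Q\<^esub>}"
proof (intro equalityI subsetI)
  fix u assume "u \<in> homog Q 0 \<inter> homog Q 1"
  then obtain x0 x1 where x: "x0 \<in> homog A 0" "x1 \<in> homog A 1" "u = proj x0" "proj x0 = proj x1"
    by (auto simp: homog_quotient)
  then obtain a where a: "a \<in> I" "x0 = a \<oplus> x1"
    using proj_eqD homog_carrier by metis
  obtain a0 a1 where a01: "a0 \<in> I" "a0 \<in> homog A 0" "a1 \<in> I" "a1 \<in> homog A 1" "a = a0 \<oplus> a1"
    using a(1) by (rule ideal_decompose)
  \<comment> \<open>The zero supplies an odd part for x0, so that both sides are homogeneous
    decompositions.\<close>
  have "x0 \<oplus> \<zero> = a0 \<oplus> (a1 \<oplus> x1)"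
    using a a01 x by (simp add: homog_carrier M.a_assoc)
  then have "x0 = a0"
    using a01 x by (intro homog_decompose_unique(1)[of x0 \<zero> a0 "a1 \<oplus> x1"]) (auto intro: homog_add)
  then show "u \<in> {\<zero>\<^bsub>Q\<^esub>}"
    using proj_eq_zero_iff[of x0] a01(1) x(1,3) by (simp add: homog_carrier)
qed (simp add: zero_mem_homog_quotient)

lemma quotient_homog_sum: "homog Q 0 <+>\<^bsub>Q\<^esub> homog Q 1 = carrier Q"
proof -
  have "homog Q 0 <+>\<^bsub>Q\<^esub> homog Q 1 = proj ` set_add A (homog A 0) (homog A 1)"
    by (auto simp: set_add_def' homog_quotient proj_add homog_carrier image_iff)
  then show ?thesis
    by (simp add: homog_sum carrier_quotient)
qed

lemma superalgebra_quotient: "superalgebra Q"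
proof (intro superalgebra.intro superalgebra_axioms.intro module_quotient quotient_finite_dimensional
    quotient_homog_submodule quotient_homog_sum quotient_homog_Int)
  fix u v i j assume "u \<in> homog Q i" "v \<in> homog Q j"
  then obtain x y where xy: "x \<in> homog A i" "u = proj x" "y \<in> homog A j" "v = proj y"
    unfolding homog_quotient by blast
  then have "u \<otimes>\<^bsub>Q\<^esub> v = proj (x \<otimes> y)"
    by (simp add: proj_mult homog_carrier)
  with mult_homog[OF xy(1,3)] show "u \<otimes>\<^bsub>Q\<^esub> v \<in> homog Q (i + j)"
    unfolding homog_quotient by blast
next
  fix u v assume "u \<in> carrier Q" "v \<in> carrier Q"
  then obtain x y where xy: "x \<in> carrier A" "u = proj x" "y \<in> carrier A" "v = proj y"
    unfolding carrier_quotient by blast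
  then show "u \<otimes>\<^bsub>Q\<^esub> v \<in> carrier Q"
    by (simp add: proj_mult)
  fix c
  show "(c \<odot>\<^bsub>Q\<^esub> u) \<otimes>\<^bsub>Q\<^esub> v = c \<odot>\<^bsub>Q\<^esub> (u \<otimes>\<^bsub>Q\<^esub> v)" "u \<otimes>\<^bsub>Q\<^esub> (c \<odot>\<^bsub>Q\<^esub> v) = c \<odot>\<^bsub>Q\<^esub> (u \<otimes>\<^bsub>Q\<^esub> v)"
    using xy by (simp_all add: proj_mult proj_smult mult_smult_left mult_smult_right)
next
  fix u v w assume "u \<in> carrier Q" "v \<in> carrier Q" "w \<in> carrier Q"
  then obtain x y z where "x \<in> carrier A" "u = proj x" "y \<in> carrier A" "v = proj y"
      "z \<in> carrier A" "w = proj z"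
    unfolding carrier_quotient by blast
  then show "(u \<oplus>\<^bsub>Q\<^esub> v) \<otimes>\<^bsub>Q\<^esub> w = u \<otimes>\<^bsub>Q\<^esub> w \<oplus>\<^bsub>Q\<^esub> v \<otimes>\<^bsub>Q\<^esub> w"
      "u \<otimes>\<^bsub>Q\<^esub> (v \<oplus>\<^bsub>Q\<^esub> w) = u \<otimes>\<^bsub>Q\<^esub> v \<oplus>\<^bsub>Q\<^esub> u \<otimes>\<^bsub>Q\<^esub> w"
    by (simp_all add: proj_mult proj_add mult_add_left mult_add_right)
qed

end

section \<open>The annihilator and the associated central extension\<close>

context superalgebra
begin

text \<open>For homogeneous x the products of a and b with x have opposite degrees and sum to zero,
  so each vanishes; additivity extends this to all x. It shows that the annihilator is
  graded.\<close>

lemma homog_in_annihilatorI: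
  assumes a: "a \<in> homog A i" and b: "b \<in> homog A (i + 1)" and ab: "a \<oplus> b \<in> annihilator A"
  shows "a \<in> annihilator A" "b \<in> annihilator A"
proof -
  note [simp] = a[THEN homog_carrier] b[THEN homog_carrier]
  have "a \<otimes> x = \<zero> \<and> x \<otimes> a = \<zero> \<and> b \<otimes> x = \<zero> \<and> x \<otimes> b = \<zero>" if "x \<in> carrier A" for x
    using that
  proof (induction x rule: homog_induct)
    case (homog j x)
    note [simp] = homog[THEN homog_carrier]
    have "a \<otimes> x \<oplus> b \<otimes> x = \<zero>" "x \<otimes> a \<oplus> x \<otimes> b = \<zero>"
      using ab homog by (simp_all add: annihilator_def flip: mult_add_left mult_add_right)
    moreover have "a \<otimes> x \<in> homog A (i + j)" "b \<otimes> x \<in> homog A (i + j + 1)"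
      "x \<otimes> a \<in> homog A (i + j)" "x \<otimes> b \<in> homog A (i + j + 1)"
      using mult_homog[OF a homog] mult_homog[OF b homog] mult_homog[OF homog a] mult_homog[OF homog b]
      by (simp_all only: add.assoc add.commute add.left_commute)
    ultimately show ?case
      using homog_sum_zero by blast
  qed (simp add: mult_add_left mult_add_right)
  then show "a \<in> annihilator A" "b \<in> annihilator A"
    by (simp_all add: annihilator_def)
qed

lemma graded_ideal_annihilator: "graded_ideal (annihilator A) A"
  unfolding graded_ideal_def
proof (intro conjI ballI)
  show submod: "submodule (annihilator A) complex_ring A"
    by (rule submoduleI)
      (auto simp: annihilator_def mult_add_left mult_add_right mult_smult_left mult_smult_right
        scalar_smult_minus_one)
  show "a \<otimes> x \<in> annihilator A" "x \<otimes> a \<in> annihilator A"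
    if "a \<in> annihilator A" "x \<in> carrier A" for a x
    using that by (simp_all add: annihilator_def)
  show "annihilator A = set_add A (annihilator A \<inter> homog A 0) (annihilator A \<inter> homog A 1)"
  proof (intro equalityI subsetI)
    fix a assume a: "a \<in> annihilator A"
    then obtain a0 a1 where a01: "a0 \<in> homog A 0" "a1 \<in> homog A 1" "a = a0 \<oplus> a1"
      using homog_decompose[of a] by (auto simp: annihilator_def)
    with a have "a0 \<in> annihilator A" "a1 \<in> annihilator A"
      using homog_in_annihilatorI[of a0 0 a1] by simp_all
    with a01 show "a \<in> set_add A (annihilator A \<inter> homog A 0) (annihilator A \<inter> homog A 1)"
      by (auto simp: set_add_def')
  qed (use submoduleE(5)[OF submod] in \<open>auto simp: set_add_def'\<close>)
qed

sublocale Ann: superalgebra_graded_ideal A "annihilator A"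
  by unfold_locales (rule graded_ideal_annihilator)

text \<open>The annihilator itself serves as the ideal, and the identity as the isomorphism.\<close>

lemma central_extension_annihilator:
  "central_extension A (quotient_superalgebra A (annihilator A))"
proof -
  have "id \<in> superalgebra_iso Q Q" for Q :: "'a set superalgebra"
    by (simp add: superalgebra_iso_def hom_def)
  then show ?thesis
    using graded_ideal_annihilator unfolding central_extension_def by blast
qed

text \<open>Triple products lie in the annihilator because all products of four elements vanish, so
  they become zero in the quotient. A nonzero triple product keeps the multiplication of the
  quotient nonzero.\<close>

lemma two_step_nilpotent_annihilator_quotient:
  assumes three: "three_step_nilpotent A" and nz: "nonzero_mult A"
  shows "two_step_nilpotent (quotient_superalgebra A (annihilator A))"
proof -
  have "(x \<otimes> y) \<otimes> z \<in> annihilator A" "x \<otimes> (y \<otimes> z) \<in> annihilator A"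
    if "x \<in> carrier A" "y \<in> carrier A" "z \<in> carrier A" for x y z
    using that three[unfolded three_step_nilpotent_def, THEN conjunct1]
    unfolding annihilator_def by (simp_all only: mult_closed mem_Collect_eq, blast+)
  then have "(\<forall>u \<in> carrier Ann.Q. \<forall>v \<in> carrier Ann.Q. \<forall>w \<in> carrier Ann.Q.
      (u \<otimes>\<^bsub>Ann.Q\<^esub> v) \<otimes>\<^bsub>Ann.Q\<^esub> w = \<zero>\<^bsub>Ann.Q\<^esub> \<and> u \<otimes>\<^bsub>Ann.Q\<^esub> (v \<otimes>\<^bsub>Ann.Q\<^esub> w) = \<zero>\<^bsub>Ann.Q\<^esub>)"
    unfolding Ann.carrier_quotient by (simp add: Ann.proj_mult Ann.proj_eq_zero_iff)
  moreover have "nonzero_mult Ann.Q"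
  proof -
    have "\<not> two_step_nilpotent A"
      using three by (simp add: three_step_nilpotent_def)
    \<comment> \<open>The failure of \<open>two_step_nilpotent\<close> could also mean zero
      multiplication; \<open>nz\<close> rules this out.\<close>
    with nz obtain x y z where xyz: "x \<in> carrier A" "y \<in> carrier A" "z \<in> carrier A"
        "(x \<otimes> y) \<otimes> z \<noteq> \<zero> \<or> x \<otimes> (y \<otimes> z) \<noteq> \<zero>"
      unfolding two_step_nilpotent_def by blast
    \<comment> \<open>The inner pair of a nonzero triple product is not annihilated, so its class in
      the quotient is nonzero.\<close>
    then have "x \<otimes> y \<notin> annihilator A \<or> y \<otimes> z \<notin> annihilator A"
      unfolding annihilator_def by blast
    with xyz show ?thesis
      unfolding nonzero_mult_def Ann.carrier_quotient
      by (metis Ann.proj_mult Ann.proj_eq_zero_iff mult_closed imageI)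
  qed
  ultimately show ?thesis
    unfolding two_step_nilpotent_def by blast
qed

end

theorem theorem12:
  fixes A :: "'a superalgebra"
  assumes "symmetric_zinbiel_superalgebra A"
    and "nonzero_mult A"
    and "\<not> two_step_nilpotent A"
  shows "(three_step_nilpotent A \<and>
          (\<exists>B :: 'a set superalgebra.
             superalgebra B \<and> two_step_nilpotent B \<and> central_extension A B)) \<and>
         (\<forall>i. \<forall>x \<in> homog A i.
            (x \<otimes>\<^bsub>A\<^esub> x) \<otimes>\<^bsub>A\<^esub> x = \<zero>\<^bsub>A\<^esub> \<and> x \<otimes>\<^bsub>A\<^esub> (x \<otimes>\<^bsub>A\<^esub> x) = \<zero>\<^bsub>A\<^esub>)"
proof -
  interpret symmetric_zinbiel_superalgebra A by fact
  have three: "three_step_nilpotent A"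
    using assms(3) by (simp add: three_step_nilpotent_def mult_4_zero)
  with assms(2) have "two_step_nilpotent (quotient_superalgebra A (annihilator A))"
    by (intro two_step_nilpotent_annihilator_quotient)
  \<comment> \<open>The witness for \<open>B\<close> is the quotient by the annihilator, whose
    elements are cosets and hence of type \<open>'a set\<close>.\<close>
  with three Ann.superalgebra_quotient central_extension_annihilator homog_cube_zero show ?thesis
    by blast
qed

end
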